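(* With $H_0(x) = 1$ and $H_1 (x)= -2x+5$, the polynomials $H_n(x)$ satisfy, for all $n\ge 2$, the three-term recursion $$ p_n (x) H_n (x) + q_n(x) H_{n-1}(x) + H_{n-2}(x) =0, $$ where $$ p_n(x) = \frac{4\, ((4 n-3)!)^2\, ((4 n-1)!)^2}{9 (3 n-2)^2 (3 n-1)^2\, ((2 n-1)!)^2\, ((6 n-5)!)^2}\, (x-1)^2 $$ and $$ q_n(x) = \frac{4 (n-1)\, (4 n-5)!\, (4 n-1)!}{3 (3 n-2) (3 n-1) (4 n+1)\, (2 n-1)!\, (6 n-5)!} \Big( 8 (4 n-3) (4 n+1) x^3 -36 (4 n-3) (4 n+1) x^2 + 6 (126 n^2-63 n-23) x-3 (108 n^2-54 n-19) \Big). $$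
   Context: For $k\ge 0$ let $a_k(x)=\sum_{m=0}^{k}\binom{3k+1-m}{k-m}x^m$, and for $n\ge 0$ let $H_n(x)=\det[a_{i+j}(x)]_{0\le i,j\le n}$ be the $(n+1)\times(n+1)$ Hankel determinant. *)

theory Defs
  imports
    "HOL-Computational_Algebra.Polynomial"
    "Jordan_Normal_Form.Determinant"
begin

definition a_poly :: "nat \<Rightarrow> rat poly" where
  "a_poly k = (\<Sum>m\<le>k. monom (of_nat ((3 * k + 1 - m) choose (k - m))) m)"

definition H_poly :: "nat \<Rightarrow> rat poly" where
  "H_poly n = det (mat (n + 1) (n + 1) (\<lambda>(i, j). a_poly (i + j)))"

text \<open>The coefficients of the recursion are used for n at least 2 only. Arguments of factorials
  are natural numbers and do not truncate in that range; all other
  differences are taken in the rationals. Polynomials are listed from the constant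
  coefficient upwards, so \<open>[:-1, 1:]\<close> is x - 1.\<close>

definition p_poly :: "nat \<Rightarrow> rat poly" where
  "p_poly n = (let N = of_nat n in
     smult
       ((4 * (fact (4 * n - 3))\<^sup>2 * (fact (4 * n - 1))\<^sup>2)
        / (9 * (3 * N - 2)\<^sup>2 * (3 * N - 1)\<^sup>2 * (fact (2 * n - 1))\<^sup>2 * (fact (6 * n - 5))\<^sup>2))
       ([:-1, 1:]\<^sup>2))"

definition q_poly :: "nat \<Rightarrow> rat poly" where
  "q_poly n = (let N = of_nat n in
     smult
       ((4 * (N - 1) * fact (4 * n - 5) * fact (4 * n - 1))
        / (3 * (3 * N - 2) * (3 * N - 1) * (4 * N + 1) * fact (2 * n - 1) * fact (6 * n - 5)))
       [: - 3 * (108 * N\<^sup>2 - 54 * N - 19),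
          6 * (126 * N\<^sup>2 - 63 * N - 23),
          - 36 * (4 * N - 3) * (4 * N + 1),
          8 * (4 * N - 3) * (4 * N + 1) :])"

end

theory Submission
  imports Defs "HOL-Computational_Algebra.Formal_Power_Series"
begin

text \<open>
  Put \<open>c = x - 1\<close>. The proof reduces the Hankel determinant to a determinant whose last column
  alone depends on \<open>x\<close>, and finds a row operation that makes this determinant trivial; the entries
  of the operated row are the coefficients of polynomials that satisfy the recursion by definition.

  \<^bold>\<open>Reduction of the determinant.\<close> One has \<open>a\<^sub>k(x) = [s\<^sup>k] (1+s)\<^bsup>3k+2\<^esup> / (1 - c s)\<close>, which suggests the
  substitution \<open>t = s/(1+s)\<^sup>3\<close> in the generating function of the \<open>a\<^sub>k(x)\<close>. It turns the Hankel matrix into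
  \<open>L M U\<close> with \<open>L\<close>, \<open>U\<close> unitriangular, where the columns of \<open>M\<close> are the coefficients of
  \<open>\<kappa>\<^bsub>j+1\<^esub>(s) - 2 c s \<kappa>\<^sub>j(s)\<close>, with \<open>\<kappa>\<^sub>0 = 0\<close>, \<open>\<kappa>\<^sub>1 = 1\<close> and
  \<open>\<kappa>\<^bsub>j+2\<^esub> = (3s + s\<^sup>2) \<kappa>\<^bsub>j+1\<^esub> + s \<kappa>\<^sub>j\<close>. In other words \<open>\<kappa>\<^sub>j\<close> is \<open>(b\<^sub>1\<^sup>j - b\<^sub>2\<^sup>j)/(b\<^sub>1 - b\<^sub>2)\<close> where
  \<open>b\<^sub>1\<close>, \<open>b\<^sub>2\<close> and \<open>1/s\<close> are the three solutions \<open>b\<close> of \<open>(1+b)\<^sup>3/b\<^sup>2 = (1+s)\<^sup>3/s\<close>. Adding \<open>2 c\<close> times the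
  next column to each column but the last, and dividing all columns by one power series with constant
  term 1, leaves the columns \<open>\<kappa>\<^sub>1, \<dots>, \<kappa>\<^sub>n, \<Sum>\<^sub>i (-2c)\<^sup>i \<kappa>\<^bsub>n+1+i\<^esub>\<close> (lemma \<open>H_poly_eq_kappa_det\<close>).

  \<^bold>\<open>The row operation.\<close> Let polynomials \<open>g\<^sub>n(b)\<close> be defined by \<open>g\<^sub>0 = 1\<close>, \<open>g\<^sub>1 = 1 + 3b\<close> and
  \<open>g\<^sub>n = ((1+b)\<^sup>3 + \<beta>\<^sub>n b\<^sup>2) g\<^bsub>n-1\<^esub> - \<alpha>\<^sub>n b\<^sup>4 g\<^bsub>n-2\<^esub>\<close>, with rational numbers \<open>\<alpha>\<^sub>n\<close>, \<open>\<beta>\<^sub>n\<close> read off from the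
  recursion to be proved. Because \<open>(1+b)\<^sup>3/b\<^sup>2\<close> acts on the \<open>\<kappa>\<^sub>j\<close> as multiplication by \<open>(1+s)\<^sup>3/s\<close>
  (lemma \<open>kappa_cube\<close>), the same recursion with \<open>(1+s)\<^sup>3/s\<close> in place of \<open>(1+b)\<^sup>3/b\<^sup>2\<close> defines functionals
  \<open>\<ell>\<^sub>n\<close>, combinations of the coefficients at \<open>s, \<dots>, s\<^sup>n\<close> in which \<open>s\<^sup>n\<close> has weight 1, such that
  \<open>\<ell>\<^sub>n(\<kappa>\<^sub>j)\<close> is the coefficient of \<open>b\<^bsup>2n+1-j\<^esup>\<close> in \<open>g\<^sub>n\<close> for \<open>j \<ge> 2\<close> (lemma \<open>ell_kappa\<close>). As \<open>g\<^sub>n\<close> has degree at most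
  \<open>n\<close>, replacing the last row by \<open>\<ell>\<^sub>n\<close> of the columns annihilates it except for its last entry, and the
  determinant becomes a number \<open>\<Delta>\<^sub>n\<close> times \<open>\<Sum>\<^sub>i (-2c)\<^sup>i [b\<^bsup>n-i\<^esup>] g\<^sub>n\<close> (lemma \<open>H_poly_eq\<close>). Hence
  \<open>H\<^sub>n(x) = \<Delta>\<^sub>n (-2c)\<^sup>n g\<^sub>n(-1/(2c))\<close>, where \<open>\<Delta>\<^bsub>n+1\<^esub>/\<Delta>\<^sub>n\<close> is the coefficient of \<open>b\<^sup>n\<close> in \<open>g\<^sub>n\<close>, and
  the recursion for \<open>H\<^sub>n\<close> is that for \<open>g\<^sub>n\<close>.

  \<^bold>\<open>The degree.\<close> The recursion for \<open>g\<^sub>n\<close> raises degrees by 3, so \<open>deg g\<^sub>n \<le> n\<close> needs an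
  argument. The \<open>g\<^sub>n\<close> satisfy a first order differential relation that involves \<open>g\<^sub>n\<close> and \<open>g\<^bsub>n+1\<^esub>\<close> (lemma
  \<open>g_poly_ladder\<close>), proved by induction. Combined with the recursion, it shows that a degree
  \<open>d > n\<close> of \<open>g\<^sub>n\<close> would satisfy \<open>d = 3n + 3/2\<close>. The same comparison at degree \<open>n\<close> gives the leading
  coefficients as products.
\<close>

section \<open>The polynomials \<open>g\<^sub>n\<close> and their differential relation\<close>

text \<open>The coefficients \<open>\<beta>\<^sub>N\<close> and \<open>\<alpha>\<^sub>N\<close> of the recursion for \<open>g\<^sub>N\<close>, as rational functions of the index.\<close>
definition rec_beta :: "rat \<Rightarrow> rat" where
  "rec_beta N = - 3 * (18 * N\<^sup>2 - 9 * N - 4) / ((4 * N - 3) * (4 * N + 1))"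

definition rec_alpha :: "rat \<Rightarrow> rat" where
  "rec_alpha N = 9 * (3 * N - 2) * (3 * N - 1) * (6 * N - 5) * (6 * N - 7)
     / (4 * (4 * N - 3)\<^sup>2 * (4 * N - 1) * (4 * N - 5))"

text \<open>The polynomials \<open>g\<^sub>n(b)\<close>; the cubic factor is \<open>(1+b)\<^sup>3 + \<beta> b\<^sup>2\<close>.\<close>
fun g_poly :: "nat \<Rightarrow> rat poly" where
  "g_poly 0 = 1"
| "g_poly (Suc 0) = [:1, 3:]"
| "g_poly (Suc (Suc n)) =
     [:1, 3, 3 + rec_beta (of_nat n + 2), 1:] * g_poly (Suc n)
     - smult (rec_alpha (of_nat n + 2)) ([:0, 0, 0, 0, 1:] * g_poly n)"

text \<open>The coefficient polynomials of the differential relation. The first is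
  \<open>b (b+1) (b-2) (b+1/4)\<close>. With \<open>T = (1+b)\<^sup>3/b\<^sup>2\<close>, it is \<open>b\<^sup>2 T (T - 27/4) / (dT/db)\<close>: up to the factor
  \<open>b\<^sup>2\<close>, the derivation is \<open>T (T - 27/4) d/dT\<close>, which vanishes at the finite branch values 0 and 27/4 of
  \<open>T\<close>. The number \<open>lad_s n\<close> is the coefficient of \<open>b\<^bsup>n-1\<^esup>\<close> in \<open>g\<^sub>n\<close> divided by that of \<open>b\<^sup>n\<close>.\<close>
definition lad_delta :: "rat poly" where
  "lad_delta = [:0, - 1/2, - 9/4, - 3/4, 1:]"

definition lad_s :: "rat \<Rightarrow> rat" where
  "lad_s N = 3 * N * (N + 1) / (2 * (4 * N + 5))"

definition lad_X :: "rat \<Rightarrow> rat poly" where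
  "lad_X N = [: - (2 * N + 3/2), - (15 * N + 9) / 2, - (3 * N / 4) - lad_s N, N:]"


lemma rec_beta_shift:
  "rec_beta (N + 2) = - 3 * (18 * (N+2)\<^sup>2 - 9 * (N+2) - 4) / ((4 * N + 5) * (4 * N + 9))"
  "rec_beta (N + 3) = - 3 * (18 * (N+3)\<^sup>2 - 9 * (N+3) - 4) / ((4 * N + 9) * (4 * N + 13))"
  by (simp_all add: rec_beta_def algebra_simps)

lemma rec_alpha_shift:
  "rec_alpha (N + 2) = 9 * (3 * N + 4) * (3 * N + 5) * (6 * N + 7) * (6 * N + 5)
     / (4 * (4 * N + 5)\<^sup>2 * (4 * N + 7) * (4 * N + 3))"
  "rec_alpha (N + 3) = 9 * (3 * N + 7) * (3 * N + 8) * (6 * N + 13) * (6 * N + 11)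
     / (4 * (4 * N + 9)\<^sup>2 * (4 * N + 11) * (4 * N + 7))"
  by (simp_all add: rec_alpha_def algebra_simps)

lemma lad_s_step:
  assumes "N \<ge> 0"
  shows "lad_s (N + 1) = lad_s N - 3 - rec_beta (N + 2)"
proof -
  have nz: "4 * N + 5 \<noteq> 0" "4 * N + 9 \<noteq> 0" using assms by auto
  have s: "lad_s (N + 1) = 3 * (N + 1) * (N + 2) / (2 * (4 * N + 9))"
    by (simp add: lad_s_def algebra_simps)
  show ?thesis unfolding rec_beta_shift s unfolding lad_s_def using nz
    by (simp add: divide_simps) (simp add: algebra_simps power2_eq_square)
qed

text \<open>The next two identities are what is left of the compatibility of the differential relation with
  the recursion once both sides are compared as polynomials in \<open>b\<close>.\<close>
lemma ladder_compat_beta: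
  assumes "N \<ge> 0"
  shows "(2 * N + 7/2) * (3 + rec_beta (N + 2)) - 3 - 3 * N / 4 - lad_s N
   = - (3 * (N+2) / 4) - lad_s (N + 2) + (2 * N + 11/2) * (3 + rec_beta (N + 3))"
proof -
  have nz: "4 * N + 5 \<noteq> 0" "4 * N + 9 \<noteq> 0" "4 * N + 13 \<noteq> 0" using assms by auto
  have s: "lad_s (N + 2) = 3 * (N + 2) * (N + 3) / (2 * (4 * N + 13))"
    by (simp add: lad_s_def algebra_simps)
  show ?thesis unfolding rec_beta_shift s unfolding lad_s_def using nz
    by (simp add: divide_simps) (simp add: algebra_simps power2_eq_square)
qed

lemma ladder_compat_alpha:
  assumes "N \<ge> 0"
  shows "(3 + rec_beta (N + 2)) * (15/4 + rec_beta (N + 2)) - 45/4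
   = rec_alpha (N + 2) * (2 * N + 3/2) - (2 * N + 11/2) * rec_alpha (N + 3)"
proof -
  have nz: "4 * N + 3 \<noteq> 0" "4 * N + 5 \<noteq> 0" "4 * N + 7 \<noteq> 0" "4 * N + 9 \<noteq> 0" "4 * N + 11 \<noteq> 0"
    using assms by auto
  have 1: "rec_alpha (N + 2) * (2 * N + 3/2)
     = 9 * (3 * N + 4) * (3 * N + 5) * (6 * N + 7) * (6 * N + 5) / (8 * (4 * N + 5)\<^sup>2 * (4 * N + 7))"
    unfolding rec_alpha_shift using nz by (simp add: divide_simps)
  have 2: "(2 * N + 11/2) * rec_alpha (N + 3)
     = 9 * (3 * N + 7) * (3 * N + 8) * (6 * N + 13) * (6 * N + 11) / (8 * (4 * N + 9)\<^sup>2 * (4 * N + 7))"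
    unfolding rec_alpha_shift using nz by (simp add: divide_simps)
  show ?thesis unfolding 1 2 rec_beta_shift using nz
    by (simp add: divide_simps) (simp add: algebra_simps power2_eq_square)
qed

text \<open>In the induction step the recursion for \<open>g\<^bsub>n+2\<^esub>\<close> is differentiated, the relations for \<open>g\<^sub>n\<close> and
  \<open>g\<^bsub>n+1\<^esub>\<close> are inserted, and \<open>\<alpha> b\<^sup>4 g\<^sub>n\<close> is eliminated by the recursion; the coefficients of \<open>g\<^bsub>n+1\<^esub>\<close> and
  \<open>g\<^bsub>n+2\<^esub>\<close> then agree by \<open>i2\<close> and \<open>i1\<close>.\<close>
lemma g_poly_ladder:
  "lad_delta * pderiv (g_poly n)
     = lad_X (of_nat n) * g_poly n + smult (2 * of_nat n + 3/2) (g_poly (Suc n))"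
proof (induction n rule: g_poly.induct)
  case 1
  show ?case by (simp add: lad_X_def lad_s_def)
next
  case 2
  show ?case by (simp add: lad_X_def lad_s_def lad_delta_def rec_beta_def rec_alpha_def pderiv_pCons)
next
  case (3 n)
  define N :: rat where "N = of_nat n"
  have N: "N \<ge> 0" by (simp add: N_def)
  define \<beta> where "\<beta> = rec_beta (N + 2)"
  define \<beta>' where "\<beta>' = rec_beta (N + 3)"
  define \<alpha> where "\<alpha> = rec_alpha (N + 2)"
  define \<alpha>' where "\<alpha>' = rec_alpha (N + 3)"
  define s where "s = lad_s N"
  have s1: "lad_s (N + 1) = s - 3 - \<beta>"
    using lad_s_step[OF N] by (simp add: s_def \<beta>_def)
  have s2: "lad_s (N + 2) = s - 6 - \<beta> - \<beta>'"
    using lad_s_step[OF N] lad_s_step[of "N + 1"] N by (simp add: s_def \<beta>_def \<beta>'_def algebra_simps)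
  have c1: "(2 * N + 7/2) * (3 + \<beta>) = (2 * N + 11/2) * (3 + \<beta>') + 15/2 + \<beta> + \<beta>'"
    using ladder_compat_beta[OF N] unfolding s2 \<beta>_def[symmetric] \<beta>'_def[symmetric] s_def[symmetric]
    by (simp add: field_simps)
  have c2: "(3 + \<beta>) * (15/4 + \<beta>) - 45/4 = \<alpha> * (2 * N + 3/2) - (2 * N + 11/2) * \<alpha>'"
    using ladder_compat_alpha[OF N] by (simp add: \<beta>_def \<alpha>_def \<alpha>'_def)
  show ?case
  proof (rule poly_eq_poly_eq_iff[THEN iffD1], rule ext)
    fix b :: rat
    define G0 G1 G2 G3 where "G0 = poly (g_poly n) b" and "G1 = poly (g_poly (Suc n)) b"
      and "G2 = poly (g_poly (Suc (Suc n))) b" and "G3 = poly (g_poly (Suc (Suc (Suc n)))) b"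
    define D0 D1 D2 where "D0 = poly (pderiv (g_poly n)) b" and "D1 = poly (pderiv (g_poly (Suc n))) b"
      and "D2 = poly (pderiv (g_poly (Suc (Suc n)))) b"
    define d where "d = - 1/2 - 9/4 * b - 3/4 * b^2 + b^3"
    define R where "R = 1 + 3 * b + (3 + \<beta>) * b^2 + b^3"
    define R' where "R' = 1 + 3 * b + (3 + \<beta>') * b^2 + b^3"
    define X0 where "X0 = - (2 * N + 3/2) - (15 * N + 9) / 2 * b + (- (3 * N / 4) - s) * b^2 + N * b^3"
    define X1 where "X1 = - (2 * N + 7/2) - (15 * N + 24) / 2 * b + (- (3 * (N + 1) / 4) - (s - 3 - \<beta>)) * b^2 + (N + 1) * b^3"
    define X2 where "X2 = - (2 * N + 11/2) - (15 * N + 39) / 2 * b + (- (3 * (N + 2) / 4) - (s - 6 - \<beta> - \<beta>')) * b^2 + (N + 2) * b^3"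
    have pX0: "poly (lad_X (of_nat n)) b = X0"
      unfolding lad_X_def N_def[symmetric] s_def[symmetric] X0_def
      by (simp add: field_simps power2_eq_square power3_eq_cube)
    have pX1: "poly (lad_X (of_nat (Suc n))) b = X1"
    proof -
      have q: "of_nat (Suc n) = N + 1" by (simp add: N_def)
      show ?thesis unfolding q lad_X_def s1 X1_def
        by (simp add: field_simps power2_eq_square power3_eq_cube)
    qed
    have pX2: "poly (lad_X (of_nat (Suc (Suc n)))) b = X2"
    proof -
      have q: "of_nat (Suc (Suc n)) = N + 2" by (simp add: N_def)
      show ?thesis unfolding q lad_X_def s2 X2_def
        by (simp add: field_simps power2_eq_square power3_eq_cube)
    qed
    have pd: "poly lad_delta b = b * d"
      by (simp add: lad_delta_def d_def algebra_simps power2_eq_square power3_eq_cube)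
    have e0: "b * d * D0 = X0 * G0 + (2 * N + 3/2) * G1"
      using arg_cong[OF "3.IH"(2), of "\<lambda>p. poly p b"]
      by (simp add: pd pX0 D0_def G0_def G1_def N_def del: g_poly.simps)
    have e1: "b * d * D1 = X1 * G1 + (2 * N + 7/2) * G2"
      using arg_cong[OF "3.IH"(1), of "\<lambda>p. poly p b"]
      by (simp add: pd pX1[simplified] D1_def G1_def G2_def N_def algebra_simps del: g_poly.simps)
    have G2: "G2 = R * G1 - \<alpha> * b^4 * G0"
      by (simp add: G2_def G1_def G0_def R_def \<alpha>_def \<beta>_def N_def algebra_simps
          power2_eq_square power3_eq_cube power4_eq_xxxx)
    have N3: "of_nat (Suc n) + 2 = N + 3" by (simp add: N_def)
    have G3: "G3 = R' * G2 - \<alpha>' * b^4 * G1"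
      unfolding G3_def g_poly.simps(3)[of "Suc n"] N3 \<alpha>'_def[symmetric] \<beta>'_def[symmetric]
      by (simp add: G2_def[symmetric] G1_def[symmetric] R'_def algebra_simps
          power2_eq_square power3_eq_cube power4_eq_xxxx del: g_poly.simps)
    have D2: "D2 = (3 + 2 * (3 + \<beta>) * b + 3 * b^2) * G1 + R * D1 - \<alpha> * (4 * b^3 * G0 + b^4 * D0)"
      unfolding D2_def g_poly.simps(3)[of n] N_def[symmetric] \<alpha>_def[symmetric] \<beta>_def[symmetric]
      by (simp add: pderiv_add pderiv_diff pderiv_smult pderiv_mult pderiv_pCons G1_def[symmetric] G0_def[symmetric]
          D1_def[symmetric] D0_def[symmetric] R_def algebra_simps
          power2_eq_square power3_eq_cube power4_eq_xxxx del: g_poly.simps)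
    have i1: "R * (2 * N + 7/2) + 4 * d + X0 = X2 + (2 * N + 11/2) * R'"
    proof -
      have "R * (2 * N + 7/2) + 4 * d + X0 - (X2 + (2 * N + 11/2) * R')
        = b^2 * ((2 * N + 7/2) * (3 + \<beta>) - ((2 * N + 11/2) * (3 + \<beta>') + 15/2 + \<beta> + \<beta>'))"
        by (simp add: R_def d_def X0_def X2_def R'_def field_simps power2_eq_square power3_eq_cube)
      then show ?thesis using c1 by simp
    qed
    have i2: "b * d * (3 + 2 * (3 + \<beta>) * b + 3 * b^2) + R * (X1 - X0 - 4 * d)
        - \<alpha> * (2 * N + 3/2) * b^4 = - (2 * N + 11/2) * \<alpha>' * b^4"
    proof -
      have "b * d * (3 + 2 * (3 + \<beta>) * b + 3 * b^2) + R * (X1 - X0 - 4 * d)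
          = b^4 * ((3 + \<beta>) * (15/4 + \<beta>) - 45/4)"
        by (simp add: R_def d_def X0_def X1_def field_simps power2_eq_square power3_eq_cube power4_eq_xxxx)
      then show ?thesis unfolding c2 by (simp add: algebra_simps)
    qed
    have "b * d * D2 = b * d * (3 + 2 * (3 + \<beta>) * b + 3 * b^2) * G1 + R * (b * d * D1)
        - 4 * d * (\<alpha> * b^4 * G0) - \<alpha> * b^4 * (b * d * D0)"
      unfolding D2 by (simp add: algebra_simps power3_eq_cube power4_eq_xxxx)
    also have "\<dots> = b * d * (3 + 2 * (3 + \<beta>) * b + 3 * b^2) * G1 + R * (X1 * G1 + (2 * N + 7/2) * G2)
        - 4 * d * (\<alpha> * b^4 * G0) - X0 * (\<alpha> * b^4 * G0) - \<alpha> * b^4 * (2 * N + 3/2) * G1"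
      unfolding e0 e1 by (simp add: algebra_simps)
    also have "\<alpha> * b^4 * G0 = R * G1 - G2" using G2 by simp
    also have "b * d * (3 + 2 * (3 + \<beta>) * b + 3 * b^2) * G1 + R * (X1 * G1 + (2 * N + 7/2) * G2)
        - 4 * d * (R * G1 - G2) - X0 * (R * G1 - G2) - \<alpha> * b^4 * (2 * N + 3/2) * G1
        = (b * d * (3 + 2 * (3 + \<beta>) * b + 3 * b^2) + R * (X1 - X0 - 4 * d)
            - \<alpha> * (2 * N + 3/2) * b^4) * G1 + (R * (2 * N + 7/2) + 4 * d + X0) * G2"
      by (simp add: algebra_simps)
    also have "\<dots> = X2 * G2 + (2 * N + 11/2) * G3"
      unfolding i1 i2 G3 by (simp add: algebra_simps)
    finally have fin: "b * d * D2 = X2 * G2 + (2 * N + 11/2) * G3" .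
    have y2: "2 * of_nat (Suc (Suc n)) + 3/2 = 2 * N + (11/2 :: rat)" by (simp add: N_def)
    show "poly (lad_delta * pderiv (g_poly (Suc (Suc n)))) b
       = poly (lad_X (of_nat (Suc (Suc n))) * g_poly (Suc (Suc n))
         + smult (2 * of_nat (Suc (Suc n)) + 3/2) (g_poly (Suc (Suc (Suc n))))) b"
      unfolding y2 poly_mult poly_add poly_smult pX2 pd using fin
      unfolding D2_def G2_def G3_def .
  qed
qed

section \<open>Degrees and leading coefficients\<close>

lemma coeff_lad_delta_pderiv:
  assumes "\<And>i. i > Suc d \<Longrightarrow> coeff p i = 0"
  shows "coeff (lad_delta * pderiv p) (Suc d + 3) = of_nat (Suc d) * coeff p (Suc d)"
  using assms by (simp add: lad_delta_def numeral_3_eq_3 coeff_pderiv)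

lemma coeff_cubic_mult:
  fixes p :: "rat poly"
  assumes "\<And>i. i > d \<Longrightarrow> coeff p i = 0"
  shows "coeff ([:c0, c1, c2, c3:] * p) (d + 3) = c3 * coeff p d"
  using assms by (simp add: numeral_3_eq_3)

text \<open>The coefficient of \<open>b\<^bsup>d+4\<^esup>\<close> in the differential relation for \<open>g\<^bsub>n+1\<^esub>\<close>, after \<open>g\<^bsub>n+2\<^esub>\<close> has been expressed by
  \<open>g\<^bsub>n+1\<^esub>\<close> and \<open>g\<^sub>n\<close>.\<close>
lemma g_poly_coeff_relation:
  assumes "\<And>i. i > Suc d \<Longrightarrow> coeff (g_poly (Suc n)) i = 0"
  shows "of_nat (Suc d) * coeff (g_poly (Suc n)) (Suc d)
    = (3 * of_nat (Suc n) + 3/2) * coeff (g_poly (Suc n)) (Suc d)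
      - (2 * of_nat (Suc n) + 3/2) * rec_alpha (of_nat n + 2) * coeff (g_poly n) d"
proof -
  let ?p = "g_poly (Suc n)"
  have quart: "coeff ([:0, 0, 0, 0, 1:] * q) (Suc d + 3) = coeff q d" for q :: "rat poly"
    by (simp add: numeral_3_eq_3)
  have "of_nat (Suc d) * coeff ?p (Suc d) = coeff (lad_delta * pderiv ?p) (Suc d + 3)"
    by (rule coeff_lad_delta_pderiv[symmetric]) (rule assms)
  also have "\<dots> = coeff (lad_X (of_nat (Suc n)) * ?p) (Suc d + 3)
      + (2 * of_nat (Suc n) + 3/2) * (coeff ([:1, 3, 3 + rec_beta (of_nat n + 2), 1:] * ?p) (Suc d + 3)
         - rec_alpha (of_nat n + 2) * coeff ([:0, 0, 0, 0, 1:] * g_poly n) (Suc d + 3))"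
    unfolding g_poly_ladder g_poly.simps(3) coeff_add coeff_smult coeff_diff ..
  also have "\<dots> = of_nat (Suc n) * coeff ?p (Suc d)
      + (2 * of_nat (Suc n) + 3/2) * (1 * coeff ?p (Suc d) - rec_alpha (of_nat n + 2) * coeff (g_poly n) d)"
    unfolding lad_X_def quart by (subst (1 2) coeff_cubic_mult) (use assms in auto)
  finally show ?thesis by (simp add: algebra_simps)
qed

lemma g_poly_degree: "i > n \<Longrightarrow> coeff (g_poly n) i = 0"
proof (induction n arbitrary: i)
  case 0
  then show ?case by (simp add: coeff_eq_0)
next
  case (Suc n)
  let ?p = "g_poly (Suc n)"
  have "degree ?p \<le> Suc n"
  proof (rule ccontr)
    assume "\<not> degree ?p \<le> Suc n"
    then obtain d where d: "degree ?p = Suc d" "d > n" by (cases "degree ?p") auto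
    have "of_nat (Suc d) * coeff ?p (Suc d) = (3 * of_nat (Suc n) + 3/2) * coeff ?p (Suc d)"
      using g_poly_coeff_relation[of d n] Suc.IH[of d] d by (simp add: coeff_eq_0)
    moreover have "coeff ?p (Suc d) \<noteq> 0"
      using d leading_coeff_0_iff[of ?p] by auto
    ultimately have "of_nat (Suc d) = (3 * of_nat (Suc n) + 3/2 :: rat)" by simp
    \<comment> \<open>the degree would be a half-integer\<close>
    then have "of_nat (2 * Suc d) = (of_nat (6 * Suc n + 3) :: rat)" by simp
    then have "2 * Suc d = 6 * Suc n + 3" by (simp only: of_nat_eq_iff)
    then show False by presburger
  qed
  then show ?case using Suc.prems by (simp add: coeff_eq_0)
qed

lemma g_poly_top_step:
  "coeff (g_poly (Suc n)) (Suc n) = rec_alpha (of_nat n + 2) * coeff (g_poly n) n"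
proof -
  have "(2 * of_nat (Suc n) + 3/2) * coeff (g_poly (Suc n)) (Suc n)
     = (2 * of_nat (Suc n) + 3/2) * (rec_alpha (of_nat n + 2) * coeff (g_poly n) n)"
    using g_poly_coeff_relation[of n n] g_poly_degree[of "Suc n"] by (simp add: algebra_simps)
  moreover have "2 * of_nat (Suc n) + 3/2 \<noteq> (0 :: rat)"
    using of_nat_0_le_iff[of "Suc n", where 'a = rat] by linarith
  ultimately show ?thesis by (simp only: mult_cancel_left simp_thms)
qed

lemma g_poly_top:
  "coeff (g_poly n) n = 3 * (3 * of_nat n + 1) * (3 * of_nat n + 2) * fact (2 * n + 1) * fact (6 * n + 1)
     / (fact (4 * n + 1) * fact (4 * n + 3))"
proof (induction n)
  case 0
  show ?case by (simp add: fact_numeral)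
next
  case (Suc n)
  define N :: rat where "N = of_nat n"
  have N: "N \<ge> 0" by (simp add: N_def)
  have f1: "fact (2 * Suc n + 1) = (2 * N + 3) * (2 * N + 2) * (fact (2 * n + 1) :: rat)"
    by (simp add: N_def algebra_simps numeral_eq_Suc)
  have f2: "fact (6 * Suc n + 1) = (6 * N + 7) * (6 * N + 6) * (6 * N + 5) * (6 * N + 4) * (6 * N + 3)
     * (6 * N + 2) * (fact (6 * n + 1) :: rat)"
  proof -
    have "6 * Suc n + 1 = Suc (Suc (Suc (Suc (Suc (Suc (6 * n + 1))))))" by simp
    then show ?thesis by (simp only: fact_Suc) (simp add: N_def mult.assoc add.commute)
  qed
  have f3: "fact (4 * Suc n + 1) = (4 * N + 5) * (4 * N + 4) * (4 * N + 3) * (4 * N + 2) * (fact (4 * n + 1) :: rat)"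
  proof -
    have "4 * Suc n + 1 = Suc (Suc (Suc (Suc (4 * n + 1))))" by simp
    then show ?thesis by (simp only: fact_Suc) (simp add: N_def mult.assoc add.commute)
  qed
  have f4: "fact (4 * Suc n + 3) = (4 * N + 7) * (4 * N + 6) * (4 * N + 5) * (4 * N + 4) * (fact (4 * n + 3) :: rat)"
  proof -
    have "4 * Suc n + 3 = Suc (Suc (Suc (Suc (4 * n + 3))))" by simp
    then show ?thesis by (simp only: fact_Suc) (simp add: N_def mult.assoc add.commute)
  qed
  define F1 F2 F3 F4 :: rat where "F1 = fact (2 * n + 1)" and "F2 = fact (6 * n + 1)"
    and "F3 = fact (4 * n + 1)" and "F4 = fact (4 * n + 3)"
  have F: "F3 \<noteq> 0" "F4 \<noteq> 0" by (simp_all add: F3_def F4_def)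
  have nz: "4 * N + 3 \<noteq> 0" "4 * N + 5 \<noteq> 0" "4 * N + 7 \<noteq> 0" "4 * N + 4 \<noteq> 0" "4 * N + 2 \<noteq> 0"
    "4 * N + 6 \<noteq> 0" "2 * N + 1 \<noteq> 0" "N + 1 \<noteq> 0" "2 * N + 3 \<noteq> 0"
    using N by auto
  have S: "of_nat (Suc n) = N + 1" by (simp add: N_def)
  have "coeff (g_poly (Suc n)) (Suc n)
     = rec_alpha (N + 2) * (3 * (3 * N + 1) * (3 * N + 2) * F1 * F2 / (F3 * F4))"
    unfolding g_poly_top_step Suc.IH N_def F1_def F2_def F3_def F4_def ..
  also have "\<dots> = 3 * (3 * N + 4) * (3 * N + 5) * ((2 * N + 3) * (2 * N + 2) * F1)
     * ((6 * N + 7) * (6 * N + 6) * (6 * N + 5) * (6 * N + 4) * (6 * N + 3) * (6 * N + 2) * F2)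
     / (((4 * N + 5) * (4 * N + 4) * (4 * N + 3) * (4 * N + 2) * F3) * ((4 * N + 7) * (4 * N + 6) * (4 * N + 5) * (4 * N + 4) * F4))"
  proof -
    have *: "(2 * N + 2) = 2 * (N + 1)" "6 * N + 6 = 6 * (N + 1)" "6 * N + 4 = 2 * (3 * N + 2)"
      "6 * N + 3 = 3 * (2 * N + 1)" "6 * N + 2 = 2 * (3 * N + 1)" "4 * N + 4 = 4 * (N + 1)"
      "4 * N + 2 = 2 * (2 * N + 1)" "4 * N + 6 = 2 * (2 * N + 3)" by simp_all
    show ?thesis unfolding rec_alpha_shift * using nz F by (simp add: divide_simps power2_eq_square) (simp add: algebra_simps)
  qed
  finally show ?case
    unfolding f1 f2 f3 f4 S F1_def F2_def F3_def F4_def by (simp add: algebra_simps)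
qed

section \<open>The series \<open>\<kappa>\<^sub>j\<close> and the functionals \<open>\<ell>\<^sub>n\<close>\<close>

no_notation vec_index (infixl "$" 100)
unbundle fps_syntax

text \<open>The power series \<open>\<kappa>\<^sub>j(s)\<close>, that is \<open>(b\<^sub>1\<^sup>j - b\<^sub>2\<^sup>j)/(b\<^sub>1 - b\<^sub>2)\<close> with \<open>b\<^sub>1 + b\<^sub>2 = 3s + s\<^sup>2\<close> and
  \<open>b\<^sub>1 b\<^sub>2 = -s\<close>.\<close>
fun kappa :: "nat \<Rightarrow> rat fps" where
  "kappa 0 = 0"
| "kappa (Suc 0) = 1"
| "kappa (Suc (Suc j)) = fps_X * ((3 + fps_X) * kappa (Suc j) + kappa j)"

lemma three_fps_nth: "((3 :: rat fps) * f) $ m = 3 * f $ m"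
  by (simp add: numeral_fps_const)

lemma kappa_nth_eq_0: "2 * m + 1 < j \<Longrightarrow> kappa j $ m = 0"
proof (induction j arbitrary: m rule: kappa.induct)
  case (3 j)
  then show ?case by (cases m) (auto simp: distrib_right three_fps_nth fps_X_mult_nth)
qed auto

lemma kappa_nth_top: "kappa (2 * m + 1) $ m = 1"
proof (induction m)
  case (Suc m)
  have "kappa (2 * Suc m + 1) = fps_X * ((3 + fps_X) * kappa (Suc (2 * m + 1)) + kappa (2 * m + 1))"
    by simp
  then have "kappa (2 * Suc m + 1) $ Suc m = ((3 + fps_X) * kappa (Suc (2 * m + 1)) + kappa (2 * m + 1)) $ m"
    by (simp add: fps_X_mult_nth del: kappa.simps)
  also have "\<dots> = 1"
    using Suc kappa_nth_eq_0[of m "Suc (2 * m + 1)"] kappa_nth_eq_0[of "m - 1" "Suc (2 * m + 1)"]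
    by (simp add: distrib_right three_fps_nth fps_X_mult_nth del: kappa.simps)
  finally show ?case .
qed simp

text \<open>Multiplication by \<open>(1+b)\<^sup>3/b\<^sup>2\<close> in the variable \<open>b\<close> is multiplication by \<open>(1+s)\<^sup>3/s\<close> in the
  variable \<open>s\<close>.\<close>
lemma kappa_cube:
  "fps_X * (kappa (Suc (Suc (Suc j))) + 3 * kappa (Suc (Suc j)) + 3 * kappa (Suc j) + kappa j)
     = (1 + fps_X) ^ 3 * kappa (Suc (Suc j))"
proof -
  define p q r where "p = kappa j" and "q = kappa (Suc j)" and "r = kappa (Suc (Suc j))"
  have r: "r = fps_X * ((3 + fps_X) * q + p)" by (simp add: p_def q_def r_def)
  have "kappa (Suc (Suc (Suc j))) = fps_X * ((3 + fps_X) * r + q)" by (simp add: q_def r_def)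
  then have "fps_X * (kappa (Suc (Suc (Suc j))) + 3 * r + 3 * q + p)
     = (3 * fps_X + 3 * fps_X ^ 2 + fps_X ^ 3) * r + fps_X * ((3 + fps_X) * q + p)"
    by (simp add: algebra_simps power2_eq_square power3_eq_cube)
  also have "\<dots> = (1 + fps_X) ^ 3 * r"
    unfolding r[symmetric] by (simp add: algebra_simps power2_eq_square power3_eq_cube)
  finally show ?thesis by (simp only: p_def q_def r_def)
qed

text \<open>The functionals \<open>\<ell>\<^sub>n\<close>. They ignore the constant coefficient, so \<open>f/s\<close> in the recursion can be
  rendered as a shift. The value \<open>\<ell>\<^sub>0 = 0\<close> makes the recursion correct from \<open>\<ell>\<^sub>2\<close> on.\<close>
fun ell :: "nat \<Rightarrow> rat fps \<Rightarrow> rat" where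
  "ell 0 f = 0"
| "ell (Suc 0) f = f $ 1"
| "ell (Suc (Suc n)) f = ell (Suc n) ((1 + fps_X) ^ 3 * fps_shift 1 f)
     + rec_beta (of_nat n + 2) * ell (Suc n) f - rec_alpha (of_nat n + 2) * ell n f"

lemma ell_add: "ell n (f + g) = ell n f + ell n g"
proof (induction n f arbitrary: g rule: ell.induct)
  case (3 n f)
  have "(1 + fps_X) ^ 3 * fps_shift 1 (f + g)
      = (1 + fps_X) ^ 3 * fps_shift 1 f + (1 + fps_X) ^ 3 * fps_shift 1 g"
    by (simp add: fps_shift_add distrib_left)
  then show ?case unfolding ell.simps(3) using 3 by (simp only: distrib_left)
qed simp_all

lemma ell_const_mult: "ell n (fps_const c * f) = c * ell n f"
proof (induction n f rule: ell.induct)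
  case (3 n f)
  have e: "(1 + fps_X) ^ 3 * fps_shift 1 (fps_const c * f) = fps_const c * ((1 + fps_X) ^ 3 * fps_shift 1 f)"
  proof -
    have "fps_shift 1 (fps_const c * f) = fps_const c * fps_shift 1 f" by (simp add: fps_eq_iff)
    then show ?thesis by (simp only: mult.left_commute)
  qed
  show ?case unfolding ell.simps(3) e 3 by (simp add: algebra_simps)
qed simp_all

lemma ell_sum: "ell n (\<Sum>i\<in>I. f i) = (\<Sum>i\<in>I. ell n (f i))"
proof (induction I rule: infinite_finite_induct)
  case (insert i I)
  then show ?case by (simp add: ell_add)
qed (use ell_const_mult[of n 0 0] in simp_all)

text \<open>\<open>\<ell>\<^sub>n\<close> is the \<open>n\<close>-th coefficient plus a combination of the coefficients with positive
  index below \<open>n\<close>.\<close>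
lemma ell_lead:
  assumes "\<And>m. 1 \<le> m \<Longrightarrow> m < n \<Longrightarrow> f $ m = 0" and "n \<ge> 1"
  shows "ell n f = f $ n"
  using assms
proof (induction n f rule: ell.induct)
  case (3 n f)
  let ?f = "(1 + fps_X) ^ 3 * fps_shift 1 f"
  have *: "?f $ m = f $ Suc m" if "m < Suc (Suc n)" for m
  proof -
    have "?f $ m = (\<Sum>i=0..m. ((1 + fps_X) ^ 3) $ i * f $ (m - i + 1))"
      by (simp add: fps_mult_nth)
    also have "\<dots> = (\<Sum>i\<in>{0}. ((1 + fps_X) ^ 3) $ i * f $ (m - i + 1))"
      by (rule sum.mono_neutral_right) (use that 3(4) in auto)
    also have "\<dots> = f $ Suc m" by (simp add: fps_power_zeroth)
    finally show ?thesis .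
  qed
  have "ell (Suc n) ?f = ?f $ Suc n"
    by (rule 3(1)) (use * 3(4) in auto)
  moreover have "ell (Suc n) f = 0"
    using 3(2) 3(4) by simp
  moreover have "ell n f = 0"
    using 3(3) 3(4) by (cases n) auto
  ultimately show ?case using * by simp
qed auto

lemma ell_expand: "ell n f = (\<Sum>m\<le>n. ell n (fps_X ^ m) * f $ m)"
proof (cases "n = 0")
  case False
  define h where "h = (\<Sum>m\<le>n. fps_const (f $ m) * fps_X ^ m)"
  have h: "h $ k = (if k \<le> n then f $ k else 0)" for k
    by (simp add: h_def fps_sum_nth fps_X_power_nth if_distrib cong: if_cong)
  have "ell n (f - h) = 0"
    using ell_lead[of n "f - h"] h False by simp
  moreover have "ell n f = ell n (f - h) + ell n h"
    by (simp flip: ell_add)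
  moreover have "ell n h = (\<Sum>m\<le>n. ell n (fps_X ^ m) * f $ m)"
    unfolding h_def ell_sum ell_const_mult by (simp only: mult.commute)
  ultimately show ?thesis by simp
qed simp

text \<open>Coefficients of a polynomial at arbitrary integer indices, zero at the negative ones. This makes
  multiplication by the variable a shift of the index.\<close>
definition int_coeff :: "rat poly \<Rightarrow> int \<Rightarrow> rat" where
  "int_coeff p k = (if k < 0 then 0 else coeff p (nat k))"

lemma int_coeff_add: "int_coeff (p + q) k = int_coeff p k + int_coeff q k"
  and int_coeff_diff: "int_coeff (p - q) k = int_coeff p k - int_coeff q k"
  and int_coeff_smult: "int_coeff (smult c p) k = c * int_coeff p k"
  by (simp_all add: int_coeff_def)

lemma int_coeff_pCons: "int_coeff (pCons 0 p) k = int_coeff p (k - 1)"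
  by (auto simp: int_coeff_def coeff_pCons nat_diff_distrib split: nat.splits)

lemma int_coeff_g_poly_Suc_Suc:
  "int_coeff (g_poly (Suc (Suc n))) k =
     int_coeff (g_poly (Suc n)) k + 3 * int_coeff (g_poly (Suc n)) (k - 1)
     + (3 + rec_beta (of_nat n + 2)) * int_coeff (g_poly (Suc n)) (k - 2)
     + int_coeff (g_poly (Suc n)) (k - 3) - rec_alpha (of_nat n + 2) * int_coeff (g_poly n) (k - 4)"
  by (simp add: int_coeff_add int_coeff_diff int_coeff_smult int_coeff_pCons algebra_simps)

lemma int_coeff_g_poly_eq_0: "k > int n \<Longrightarrow> int_coeff (g_poly n) k = 0"
  by (simp add: int_coeff_def g_poly_degree)

lemma ell_kappa:
  assumes "j \<ge> 2"
  shows "ell n (kappa j) = int_coeff (g_poly n) (2 * int n + 1 - int j)"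
  using assms
proof (induction n arbitrary: j rule: g_poly.induct)
  case 1
  then show ?case by (simp add: int_coeff_def)
next
  case 2
  consider "j = 2" | "j = 3" | "j \<ge> 4" using 2 by linarith
  then show ?case
  proof cases
    case 1
    then show ?thesis by (simp add: numeral_2_eq_2 int_coeff_def)
  next
    case 2
    then show ?thesis using kappa_nth_top[of 1] by (simp add: int_coeff_def)
  next
    case 3
    then show ?thesis using kappa_nth_eq_0[of 1 j] by (simp add: int_coeff_def)
  qed
next
  case (3 n)
  \<comment> \<open>For \<open>\<kappa>\<^sub>0\<close> and \<open>\<kappa>\<^sub>1\<close> both sides vanish: \<open>\<ell>\<close> ignores constants, and \<open>2n+2\<close> exceeds the degree.\<close>
  have IH: "ell (Suc n) (kappa j) = int_coeff (g_poly (Suc n)) (2 * int n + 3 - int j)" for j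
  proof (cases "j \<ge> 2")
    case True
    then show ?thesis using "3.IH"(1)[of j] by (simp add: algebra_simps)
  next
    case False
    then have "j = 0 \<or> j = Suc 0" by linarith
    then have "ell (Suc n) (kappa j) = 0"
      by (auto simp: ell_lead)
    then show ?thesis using False by (simp add: int_coeff_g_poly_eq_0 del: g_poly.simps)
  qed
  obtain i where i: "j = Suc (Suc i)" using 3(3) by (metis add_2_eq_Suc le_Suc_ex)
  have "(1 + fps_X) ^ 3 * fps_shift 1 (kappa j)
      = kappa (Suc (Suc (Suc i))) + 3 * kappa (Suc (Suc i)) + 3 * kappa (Suc i) + kappa i"
  proof -
    have "kappa j = fps_X * fps_shift 1 (kappa j)"
      unfolding i by (simp add: fps_eq_iff fps_X_mult_nth)
    then have "fps_X * ((1 + fps_X) ^ 3 * fps_shift 1 (kappa j)) = (1 + fps_X) ^ 3 * kappa j"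
      by (metis mult.left_commute)
    also note kappa_cube[of i, folded i, symmetric]
    finally show ?thesis unfolding i by (simp only: mult_cancel_left fps_X_neq_zero simp_thms)
  qed
  then have "ell (Suc (Suc n)) (kappa j) = ell (Suc n) (kappa (j + 1)) + 3 * ell (Suc n) (kappa j)
      + 3 * ell (Suc n) (kappa (Suc i)) + ell (Suc n) (kappa i)
      + rec_beta (of_nat n + 2) * ell (Suc n) (kappa j) - rec_alpha (of_nat n + 2) * ell n (kappa j)"
    using ell_const_mult[of "Suc n" 3] by (simp add: ell_add i numeral_fps_const del: kappa.simps)
  also have "\<dots> = int_coeff (g_poly (Suc (Suc n))) (2 * int (Suc (Suc n)) + 1 - int j)"
    unfolding IH "3.IH"(2)[OF 3(3)] int_coeff_g_poly_Suc_Suc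
    unfolding i by (simp add: algebra_simps del: g_poly.simps)
  finally show ?case .
qed

section \<open>Determinants under unitriangular operations\<close>

lemma det_mat_mult:
  fixes A B :: "nat \<Rightarrow> nat \<Rightarrow> rat"
  shows "det (mat N N (\<lambda>(i, j). \<Sum>k<N. A i k * B k j))
    = det (mat N N (\<lambda>(i, j). A i j)) * det (mat N N (\<lambda>(i, j). B i j))"
proof -
  have "mat N N (\<lambda>(i, j). A i j) * mat N N (\<lambda>(i, j). B i j)
      = mat N N (\<lambda>(i, j). \<Sum>k<N. A i k * B k j)"
    by (rule eq_matI) (auto simp: scalar_prod_def atLeast0LessThan)
  then show ?thesis by (metis det_mult mat_carrier)
qed

lemma det_unit_lower:
  fixes A :: "nat \<Rightarrow> nat \<Rightarrow> rat"
  assumes "\<And>i. i < N \<Longrightarrow> A i i = 1" "\<And>i j. i < j \<Longrightarrow> j < N \<Longrightarrow> A i j = 0"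
  shows "det (mat N N (\<lambda>(i, j). A i j)) = 1"
proof -
  have "det (mat N N (\<lambda>(i, j). A i j)) = prod_list (diag_mat (mat N N (\<lambda>(i, j). A i j)))"
    by (rule det_lower_triangular[where n = N]) (use assms in auto)
  also have "\<dots> = 1"
    using assms by (simp add: prod_list_diag_prod)
  finally show ?thesis .
qed

lemma det_unit_upper:
  fixes A :: "nat \<Rightarrow> nat \<Rightarrow> rat"
  assumes "\<And>i. i < N \<Longrightarrow> A i i = 1" "\<And>i j. j < i \<Longrightarrow> i < N \<Longrightarrow> A i j = 0"
  shows "det (mat N N (\<lambda>(i, j). A i j)) = 1"
proof -
  have "det (mat N N (\<lambda>(i, j). A i j)) = prod_list (diag_mat (mat N N (\<lambda>(i, j). A i j)))"
    by (rule det_upper_triangular[where n = N]) (use assms in \<open>auto simp: upper_triangular_def\<close>)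
  also have "\<dots> = 1"
    using assms by (simp add: prod_list_diag_prod)
  finally show ?thesis .
qed

lemma det_cong:
  assumes "\<And>i j. i < N \<Longrightarrow> j < N \<Longrightarrow> A i j = B i j"
  shows "det (mat N N (\<lambda>(i, j). A i j)) = det (mat N N (\<lambda>(i, j). B i j))"
  by (rule arg_cong[where f = det]) (rule eq_matI; use assms in auto)

text \<open>Multiplying the \<open>i\<close>-th row, read as "coefficient at \<open>s\<^sup>i\<close>", by a series with constant term 1
  is a unitriangular row operation.\<close>
lemma det_unit_series_rows:
  fixes e f :: "nat \<Rightarrow> rat fps"
  assumes "\<And>i. i < N \<Longrightarrow> e i $ 0 = 1"
  shows "det (mat N N (\<lambda>(i, j). (e i * f j) $ i)) = det (mat N N (\<lambda>(i, j). f j $ i))"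
proof -
  define P where "P i k = (if k \<le> i then e i $ (i - k) else 0)" for i k
  have "(e i * f j) $ i = (\<Sum>k<N. P i k * f j $ k)" if "i < N" for i j
  proof -
    have "(e i * f j) $ i = (\<Sum>k\<le>i. f j $ k * e i $ (i - k))"
      by (simp add: mult.commute[of "e i"] fps_mult_nth atLeast0AtMost)
    also have "\<dots> = (\<Sum>k\<le>i. P i k * f j $ k)" by (simp add: P_def mult.commute)
    also have "\<dots> = (\<Sum>k<N. P i k * f j $ k)"
      by (rule sum.mono_neutral_left) (use that in \<open>auto simp: P_def\<close>)
    finally show ?thesis .
  qed
  then have "det (mat N N (\<lambda>(i, j). (e i * f j) $ i))
      = det (mat N N (\<lambda>(i, j). \<Sum>k<N. P i k * f j $ k))"
    by (rule det_cong)
  also have "\<dots> = det (mat N N (\<lambda>(i, j). f j $ i))"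
    unfolding det_mat_mult by (subst det_unit_lower) (use assms in \<open>auto simp: P_def\<close>)
  finally show ?thesis .
qed

section \<open>Factorization of the Hankel matrix\<close>

text \<open>The columns of the matrix \<open>M\<close>.\<close>
definition m_ser :: "rat \<Rightarrow> nat \<Rightarrow> rat fps" where
  "m_ser c j = kappa (Suc j) - fps_const (2 * c) * fps_X * kappa j"

text \<open>The operator \<open>T_op c\<close> is multiplication by \<open>(1+s)\<^sup>3/s\<close>, that is by \<open>1/t\<close>, corrected by a multiple of a
  fixed series so that no pole arises. Its \<open>j\<close>-th iterate on 1 represents the \<open>j\<close>-th column of the
  Hankel matrix, in the sense of lemma \<open>E_ser_Hankel\<close>.\<close>
definition gam :: "rat \<Rightarrow> rat fps" where
  "gam c = (1 - 2 * fps_X) * (1 - fps_const c * fps_X)"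

definition T_op :: "rat \<Rightarrow> rat fps \<Rightarrow> rat fps" where
  "T_op c f = fps_shift 1 ((1 + fps_X) ^ 3 * f - fps_const (f $ 0) * gam c)"

lemma X_T_op: "fps_X * T_op c f = (1 + fps_X) ^ 3 * f - fps_const (f $ 0) * gam c"
  by (rule fps_ext) (simp add: T_op_def gam_def fps_power_zeroth)

lemma T_op_eqI:
  assumes "fps_X * g = (1 + fps_X) ^ 3 * f - fps_const (f $ 0) * gam c"
  shows "T_op c f = g"
  using assms X_T_op[of c f] by (metis fps_X_neq_zero mult_cancel_left)

lemma T_op_add: "T_op c (f + g) = T_op c f + T_op c g"
  by (rule T_op_eqI) (simp add: distrib_left X_T_op algebra_simps flip: fps_const_add)

lemma T_op_const_mult: "T_op c (fps_const a * f) = fps_const a * T_op c f"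
  by (rule T_op_eqI) (simp add: mult.left_commute[of fps_X] X_T_op algebra_simps flip: fps_const_mult)

lemma T_op_sum: "T_op c (\<Sum>i\<in>I. f i) = (\<Sum>i\<in>I. T_op c (f i))"
proof (induction I rule: infinite_finite_induct)
  case (insert i I)
  then show ?case by (simp add: T_op_add)
qed (use T_op_const_mult[of c 0 0] in simp_all)

lemma m_ser_rec: "m_ser c (Suc (Suc l)) = fps_X * ((3 + fps_X) * m_ser c (Suc l) + m_ser c l)"
  by (simp add: m_ser_def algebra_simps)

lemma m_ser_0: "m_ser c 0 = 1"
  by (simp add: m_ser_def)

lemma m_ser_1: "m_ser c (Suc 0) = fps_X * (3 + fps_X - fps_const (2 * c))"
  by (simp add: m_ser_def algebra_simps)

lemma m_ser_Suc_nth_0: "m_ser c (Suc l) $ 0 = 0"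
  by (simp add: m_ser_def)

lemma fps_const_linear:
  "fps_const (2 * c) = 2 * fps_const (c :: rat)" "fps_const (5 + c) = 5 + fps_const c"
  "fps_const (3 - 2 * c) = 3 - 2 * fps_const c" "fps_const 3 = (3 :: rat fps)"
  by (simp_all add: numeral_fps_const)

lemma T_op_m_ser_0: "T_op c (m_ser c 0) = m_ser c (Suc 0) + fps_const (5 + c) * m_ser c 0"
  by (rule T_op_eqI, unfold m_ser_0 m_ser_1 gam_def fps_const_linear)
    (simp add: algebra_simps power3_eq_cube)

lemma T_op_m_ser_1: "T_op c (m_ser c (Suc 0))
    = m_ser c (Suc (Suc 0)) + fps_const 3 * m_ser c (Suc 0) + fps_const (3 - 2 * c) * m_ser c 0"
  by (rule T_op_eqI, unfold m_ser_rec m_ser_Suc_nth_0 m_ser_0 m_ser_1 fps_const_linear)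
    (simp add: algebra_simps power3_eq_cube)

lemma T_op_m_ser_Suc_Suc: "T_op c (m_ser c (Suc (Suc l)))
    = m_ser c (Suc (Suc (Suc l))) + fps_const 3 * m_ser c (Suc (Suc l))
      + fps_const 3 * m_ser c (Suc l) + m_ser c l"
proof (rule T_op_eqI)
  define p q r where "p = m_ser c l" and "q = m_ser c (Suc l)" and "r = m_ser c (Suc (Suc l))"
  have r: "r = fps_X * ((3 + fps_X) * q + p)" by (simp add: p_def q_def r_def m_ser_rec)
  have s: "m_ser c (Suc (Suc (Suc l))) = fps_X * ((3 + fps_X) * r + q)"
    by (simp add: q_def r_def m_ser_rec)
  have "fps_X * (fps_X * ((3 + fps_X) * r + q) + 3 * r + 3 * q + p)
     = (3 * fps_X + 3 * fps_X ^ 2 + fps_X ^ 3) * r + fps_X * ((3 + fps_X) * q + p)"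
    by (simp add: algebra_simps power2_eq_square power3_eq_cube)
  also have "\<dots> = (1 + fps_X) ^ 3 * r"
    unfolding r[symmetric] by (simp add: algebra_simps power2_eq_square power3_eq_cube)
  finally show "fps_X * (m_ser c (Suc (Suc (Suc l))) + fps_const 3 * m_ser c (Suc (Suc l))
      + fps_const 3 * m_ser c (Suc l) + m_ser c l)
      = (1 + fps_X) ^ 3 * m_ser c (Suc (Suc l)) - fps_const (m_ser c (Suc (Suc l)) $ 0) * gam c"
    unfolding s m_ser_Suc_nth_0 p_def q_def r_def by (simp add: numeral_fps_const)
qed

text \<open>The linear span of the first \<open>j\<close> of the series \<open>m_ser c\<close>. The iterates of \<open>T_op c\<close> on 1 agree with these series modulo
  the preceding ones, so they are related by a unitriangular column operation.\<close>
definition m_span :: "rat \<Rightarrow> nat \<Rightarrow> rat fps set" where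
  "m_span c j = {f. \<exists>w. f = (\<Sum>l<j. fps_const (w l) * m_ser c l)}"

lemma m_span_add: "f \<in> m_span c j \<Longrightarrow> g \<in> m_span c j \<Longrightarrow> f + g \<in> m_span c j"
proof -
  assume "f \<in> m_span c j" "g \<in> m_span c j"
  then obtain v w where "f = (\<Sum>l<j. fps_const (v l) * m_ser c l)" "g = (\<Sum>l<j. fps_const (w l) * m_ser c l)"
    by (auto simp: m_span_def)
  then have "f + g = (\<Sum>l<j. fps_const (v l + w l) * m_ser c l)"
    by (simp add: sum.distrib distrib_right flip: fps_const_add)
  then show ?thesis unfolding m_span_def by (intro CollectI exI)
qed

lemma m_span_const_mult: "f \<in> m_span c j \<Longrightarrow> fps_const a * f \<in> m_span c j"
proof -
  assume "f \<in> m_span c j"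
  then obtain v where "f = (\<Sum>l<j. fps_const (v l) * m_ser c l)"
    by (auto simp: m_span_def)
  then have "fps_const a * f = (\<Sum>l<j. fps_const (a * v l) * m_ser c l)"
    by (simp add: sum_distrib_left mult.assoc flip: fps_const_mult)
  then show ?thesis unfolding m_span_def by (intro CollectI exI)
qed

lemma m_span_base: "l < j \<Longrightarrow> m_ser c l \<in> m_span c j"
proof -
  assume "l < j"
  then have "m_ser c l = (\<Sum>k<j. fps_const (if k = l then 1 else 0) * m_ser c k)"
    by (subst sum.remove[of _ l]) (auto intro!: sum.neutral)
  then show ?thesis unfolding m_span_def by (intro CollectI exI)
qed

lemma m_span_sum: "(\<And>i. i \<in> I \<Longrightarrow> f i \<in> m_span c j) \<Longrightarrow> (\<Sum>i\<in>I. f i) \<in> m_span c j"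
proof (induction I rule: infinite_finite_induct)
  case (insert i I)
  then show ?case by (simp add: m_span_add)
qed (auto simp: m_span_def intro!: exI[of _ "\<lambda>_. 0"])

lemma T_op_m_ser: "\<exists>f \<in> m_span c (Suc j). T_op c (m_ser c j) = m_ser c (Suc j) + f"
proof -
  consider "j = 0" | "j = Suc 0" | l where "j = Suc (Suc l)" by (metis not0_implies_Suc)
  then show ?thesis
  proof cases
    case 1
    then show ?thesis
      by (auto simp: T_op_m_ser_0 intro!: bexI[of _ "fps_const (5 + c) * m_ser c 0"]
          m_span_const_mult m_span_base)
  next
    case 2
    then show ?thesis
      by (auto simp: T_op_m_ser_1 add.assoc intro!: m_span_add m_span_const_mult m_span_base
          bexI[of _ "fps_const 3 * m_ser c (Suc 0) + fps_const (3 - 2 * c) * m_ser c 0"])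
  next
    case 3
    then show ?thesis
      by (auto simp: T_op_m_ser_Suc_Suc add.assoc intro!: m_span_add m_span_const_mult m_span_base
          bexI[of _ "fps_const 3 * m_ser c (Suc (Suc l)) + (fps_const 3 * m_ser c (Suc l) + m_ser c l)"])
  qed
qed

lemma m_span_mono:
  assumes "f \<in> m_span c j" "j \<le> k"
  shows "f \<in> m_span c k"
proof -
  obtain w where "f = (\<Sum>l<j. fps_const (w l) * m_ser c l)" using assms(1) by (auto simp: m_span_def)
  moreover have "(\<Sum>l<j. fps_const (w l) * m_ser c l) \<in> m_span c k"
    by (intro m_span_sum m_span_const_mult m_span_base) (use assms(2) in auto)
  ultimately show ?thesis by simp
qed

lemma T_op_funpow_m_ser: "\<exists>f \<in> m_span c j. (T_op c ^^ j) 1 = m_ser c j + f"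
proof (induction j)
  case 0
  have "0 \<in> m_span c 0" by (simp add: m_span_def)
  then show ?case by (auto simp: m_ser_0)
next
  case (Suc j)
  then obtain f where f: "f \<in> m_span c j" "(T_op c ^^ j) 1 = m_ser c j + f" by blast
  obtain h where h: "h \<in> m_span c (Suc j)" "T_op c (m_ser c j) = m_ser c (Suc j) + h"
    using T_op_m_ser by blast
  obtain w where w: "f = (\<Sum>l<j. fps_const (w l) * m_ser c l)" using f(1) by (auto simp: m_span_def)
  have "T_op c (m_ser c l) \<in> m_span c (Suc j)" if "l < j" for l
  proof -
    obtain h' where h': "h' \<in> m_span c (Suc l)" "T_op c (m_ser c l) = m_ser c (Suc l) + h'"
      using T_op_m_ser by blast
    then show ?thesis using that
      by (auto intro!: m_span_add m_span_base intro: m_span_mono)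
  qed
  then have "T_op c f \<in> m_span c (Suc j)"
    unfolding w T_op_sum T_op_const_mult by (intro m_span_sum m_span_const_mult) auto
  moreover have "(T_op c ^^ Suc j) 1 = m_ser c (Suc j) + (h + T_op c f)"
    by (simp add: f(2) T_op_add h(2))
  ultimately show ?case using h(1) m_span_add by blast
qed

text \<open>The series \<open>(1+s)\<^bsup>3i+2\<^esup>/(1 - c s)\<close>, whose \<open>i\<close>-th coefficient is \<open>a\<^sub>i(1+c)\<close>.\<close>
definition E_ser :: "rat \<Rightarrow> nat \<Rightarrow> rat fps" where
  "E_ser c i = (1 + fps_X) ^ (3 * i + 2) * inverse (1 - fps_const c * fps_X)"

lemma E_ser_mult: "E_ser c i * (1 - fps_const c * fps_X) = (1 + fps_X) ^ (3 * i + 2)"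
  by (simp add: E_ser_def mult.assoc inverse_mult_eq_1)

lemma one_plus_X_power_nth: "((1 + fps_X) ^ n :: rat fps) $ k = of_nat (n choose k)"
proof (induction n arbitrary: k)
  case (Suc n)
  then show ?case by (cases k) (simp_all add: distrib_right)
qed (simp add: binomial_eq_0)

text \<open>This vanishing, a relation between two neighbouring binomial coefficients, is the reason why the correction
  in \<open>T_op c\<close> does not disturb the Hankel property below.\<close>
lemma E_ser_gam_nth: "(E_ser c i * gam c) $ Suc i = 0"
proof -
  have "E_ser c i * gam c = (1 + fps_X) ^ (3 * i + 2) * (1 - 2 * fps_X)"
    unfolding gam_def E_ser_mult[symmetric, of i c] by (simp add: mult_ac)
  also have "\<dots> $ Suc i = of_nat ((3 * i + 2) choose Suc i) - 2 * of_nat ((3 * i + 2) choose i)"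
  proof -
    have e: "P * (1 - 2 * fps_X) = P - fps_const 2 * (fps_X * P)" for P :: "rat fps"
      by (simp add: algebra_simps numeral_fps_const)
    show ?thesis unfolding e by (simp add: one_plus_X_power_nth del: power_Suc power_add_numeral2)
  qed
  also have "\<dots> = 0"
  proof -
    have "Suc i * ((3 * i + 2) choose Suc i) = Suc i * (2 * ((3 * i + 2) choose i))"
      using Suc_times_binomial_add[of i "2 * i + 1"] by (simp add: algebra_simps)
    then have "(3 * i + 2) choose Suc i = 2 * ((3 * i + 2) choose i)" by (simp only: mult_cancel1) simp
    then show ?thesis by simp
  qed
  finally show ?thesis .
qed

lemma E_ser_Suc: "E_ser c (Suc i) = E_ser c i * (1 + fps_X) ^ 3"
proof -
  have "3 * Suc i + 2 = (3 * i + 2) + 3" by simp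
  then show ?thesis by (simp only: E_ser_def power_add mult_ac)
qed

lemma E_ser_Hankel: "(E_ser c i * (T_op c ^^ j) 1) $ i = E_ser c (i + j) $ (i + j)"
proof (induction j arbitrary: i)
  case (Suc j)
  let ?z = "(T_op c ^^ j) 1"
  have "(E_ser c i * (T_op c ^^ Suc j) 1) $ i = (fps_X * (E_ser c i * T_op c ?z)) $ Suc i"
    by simp
  also have "fps_X * (E_ser c i * T_op c ?z)
      = E_ser c (Suc i) * ?z - fps_const (?z $ 0) * (E_ser c i * gam c)"
    unfolding mult.left_commute[of fps_X] X_T_op E_ser_Suc by (simp add: algebra_simps)
  also have "\<dots> $ Suc i = (E_ser c (Suc i) * ?z) $ Suc i"
    by (simp add: E_ser_gam_nth)
  also have "\<dots> = E_ser c (i + Suc j) $ (i + Suc j)" by (simp add: Suc)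
  finally show ?case .
qed simp

text \<open>Since \<open>1 - (x-1) s = (1+s) - x s\<close>, expanding the quotient in powers of \<open>x s/(1+s)\<close> yields the sum
  that defines \<open>a\<^sub>k(x)\<close>; the remainder after \<open>k+1\<close> terms is divisible by \<open>s\<^bsup>k+1\<^esup>\<close>.\<close>
lemma E_ser_diag: "E_ser (x - 1) k $ k = poly (a_poly k) x"
proof -
  define D where "D = (1 + fps_X - fps_const x * fps_X :: rat fps)"
  define S where "S = (\<Sum>m\<le>k. fps_const (x ^ m) * (fps_X ^ m * (1 + fps_X) ^ (3 * k + 1 - m)) :: rat fps)"
  have D: "1 - fps_const (x - 1) * fps_X = D"
    by (simp add: D_def algebra_simps flip: fps_const_sub)
  have tel: "(\<Sum>m\<le>j. fps_const (x ^ m) * (fps_X ^ m * (1 + fps_X) ^ (3 * k + 1 - m))) * D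
      = (1 + fps_X) ^ (3 * k + 2) - fps_const (x ^ Suc j) * (fps_X ^ Suc j * (1 + fps_X) ^ (3 * k + 1 - j))"
    if "j \<le> k" for j
    using that
  proof (induction j)
    case 0
    show ?case by (simp add: D_def algebra_simps)
  next
    case (Suc j)
    have e: "3 * k + 1 - j = Suc (3 * k + 1 - Suc j)" using Suc.prems by simp
    have "fps_const (x ^ Suc j) * (fps_X ^ Suc j * (1 + fps_X) ^ (3 * k + 1 - Suc j)) * D
      = fps_const (x ^ Suc j) * (fps_X ^ Suc j * (1 + fps_X) ^ (3 * k + 1 - j))
        - fps_const (x ^ Suc (Suc j)) * (fps_X ^ Suc (Suc j) * (1 + fps_X) ^ (3 * k + 1 - Suc j))"
      unfolding e D_def by (simp add: algebra_simps flip: fps_const_mult)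
    then show ?case using Suc by (simp add: distrib_right)
  qed
  have inv: "D * inverse D = 1" by (rule inverse_mult_eq_1') (simp add: D_def)
  have "E_ser (x - 1) k = S + fps_X ^ Suc k * (fps_const (x ^ Suc k) * (1 + fps_X) ^ (2 * k + 1) * inverse D)"
  proof -
    have "E_ser (x - 1) k * D = S * D + fps_X ^ Suc k * (fps_const (x ^ Suc k) * (1 + fps_X) ^ (2 * k + 1))"
      using tel[of k] E_ser_mult[of "x - 1" k] unfolding D S_def
      by (simp add: mult_ac)
    then have "E_ser (x - 1) k * D * inverse D
      = S * D * inverse D + fps_X ^ Suc k * (fps_const (x ^ Suc k) * (1 + fps_X) ^ (2 * k + 1)) * inverse D"
      by (simp add: distrib_right)
    then show ?thesis by (simp only: mult.assoc inv mult_1_right)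
  qed
  then have "E_ser (x - 1) k $ k = S $ k"
    by (simp add: fps_X_power_mult_nth del: power_Suc)
  also have "\<dots> = (\<Sum>m\<le>k. x ^ m * of_nat ((3 * k + 1 - m) choose (k - m)))"
    unfolding S_def fps_sum_nth
    by (rule sum.cong) (auto simp: fps_X_power_mult_nth one_plus_X_power_nth simp del: fps_const_power)
  also have "\<dots> = poly (a_poly k) x"
    by (simp add: a_poly_def poly_sum poly_monom mult.commute)
  finally show ?thesis .
qed

text \<open>The series \<open>(1 + 2 c b\<^sub>1) (1 + 2 c b\<^sub>2)\<close>.\<close>
definition N_ker :: "rat \<Rightarrow> rat fps" where
  "N_ker c = 1 + fps_const (2 * c) * fps_X * (3 + fps_X) - fps_const (4 * c\<^sup>2) * fps_X"

lemma N_ker_kappa: "N_ker c * kappa (Suc j) = m_ser c j + fps_const (2 * c) * m_ser c (Suc j)"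
proof -
  have "fps_const (4 * c\<^sup>2) = fps_const (2 * c) * fps_const (2 * c)"
    by (simp add: power2_eq_square)
  then show ?thesis
    by (simp add: N_ker_def m_ser_def algebra_simps del: fps_const_mult)
qed

text \<open>The last column, \<open>(b\<^sub>1\<^bsup>n+1\<^esup>/(1 + 2 c b\<^sub>1) - b\<^sub>2\<^bsup>n+1\<^esup>/(1 + 2 c b\<^sub>2))/(b\<^sub>1 - b\<^sub>2)\<close> up to terms of order
  above \<open>n\<close>.\<close>
definition y_ser :: "rat \<Rightarrow> nat \<Rightarrow> rat fps" where
  "y_ser c n = (\<Sum>i\<le>n. fps_const ((- 2 * c) ^ i) * kappa (n + 1 + i))"

lemma N_ker_y_ser:
  assumes "k \<le> n"
  shows "(N_ker c * y_ser c n) $ k = m_ser c n $ k"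
proof -
  have tel: "(\<Sum>i\<le>l. fps_const ((- 2 * c) ^ i) * (m_ser c (n + i) + fps_const (2 * c) * m_ser c (Suc (n + i))))
      = m_ser c n - fps_const ((- 2 * c) ^ Suc l) * m_ser c (Suc (n + l))" for l
  proof (induction l)
    case (Suc l)
    have e: "fps_const ((- 2 * c) ^ Suc l) * fps_const (2 * c) = - fps_const ((- 2 * c) ^ Suc (Suc l))"
      by (simp add: mult_ac)
    have "fps_const ((- 2 * c) ^ Suc l) * (m_ser c (n + Suc l) + fps_const (2 * c) * m_ser c (Suc (n + Suc l)))
      = fps_const ((- 2 * c) ^ Suc l) * m_ser c (Suc (n + l))
        - fps_const ((- 2 * c) ^ Suc (Suc l)) * m_ser c (Suc (n + Suc l))"
      unfolding distrib_left mult.assoc[symmetric] e by (simp only: mult_minus_left add_uminus_conv_diff add_Suc_right)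
    then show ?case using Suc by (simp del: power_Suc)
  next
    case 0
    have e: "fps_const ((- 2 * c) ^ Suc 0) = - fps_const (2 * c)" by simp
    show ?case unfolding e by (simp add: algebra_simps del: fps_const_neg)
  qed
  have "N_ker c * y_ser c n
      = (\<Sum>i\<le>n. fps_const ((- 2 * c) ^ i) * (m_ser c (n + i) + fps_const (2 * c) * m_ser c (Suc (n + i))))"
    unfolding y_ser_def sum_distrib_left
    by (rule sum.cong) (simp_all add: mult.left_commute[of "N_ker c"] N_ker_kappa del: fps_const_power)
  also note tel
  finally have "N_ker c * y_ser c n = m_ser c n - fps_const ((- 2 * c) ^ Suc n) * m_ser c (Suc (n + n))" .
  moreover have "m_ser c (Suc (n + n)) $ k = 0"
    using assms kappa_nth_eq_0[of k "Suc (Suc (n + n))"] kappa_nth_eq_0[of "k - 1" "Suc (n + n)"]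
    by (auto simp: m_ser_def mult.assoc simp del: kappa.simps)
  ultimately show ?thesis by (simp del: power_Suc)
qed

section \<open>Evaluation of the determinant\<close>

text \<open>The determinant with columns \<open>\<kappa>\<^sub>1, \<dots>, \<kappa>\<^sub>n, f\<close> and rows indexed by the powers \<open>s\<^sup>0, \<dots>, s\<^sup>n\<close>.\<close>
definition kappa_det :: "nat \<Rightarrow> rat fps \<Rightarrow> rat" where
  "kappa_det n f = det (mat (Suc n) (Suc n) (\<lambda>(i, j). (if j < n then kappa (Suc j) else f) $ i))"

interpretation poly_eval: comm_ring_hom "\<lambda>p. poly p (x :: rat)" for x
  by unfold_locales simp_all

lemma H_poly_eval:
  "poly (H_poly n) x = det (mat (Suc n) (Suc n) (\<lambda>(i, j). poly (a_poly (i + j)) x))"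
proof -
  have "poly (H_poly n) x = det (map_mat (\<lambda>p. poly p x) (mat (Suc n) (Suc n) (\<lambda>(i, j). a_poly (i + j))))"
    unfolding H_poly_def by simp
  also have "map_mat (\<lambda>p. poly p x) (mat (Suc n) (Suc n) (\<lambda>(i, j). a_poly (i + j)))
      = mat (Suc n) (Suc n) (\<lambda>(i, j). poly (a_poly (i + j)) x)"
    by (rule eq_matI) auto
  finally show ?thesis .
qed

lemma H_poly_eq_kappa_det: "poly (H_poly n) x = kappa_det n (y_ser (x - 1) n)"
proof -
  define c where "c = x - 1"
  let ?z = "\<lambda>j. (T_op c ^^ j) 1"
  have "poly (H_poly n) x = det (mat (Suc n) (Suc n) (\<lambda>(i, j). (E_ser c i * ?z j) $ i))"
    by (simp add: H_poly_eval E_ser_Hankel E_ser_diag c_def)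
  also have "\<dots> = det (mat (Suc n) (Suc n) (\<lambda>(i, j). ?z j $ i))"
    by (rule det_unit_series_rows) (simp add: E_ser_def fps_power_zeroth)
  also have "\<dots> = det (mat (Suc n) (Suc n) (\<lambda>(i, j). m_ser c j $ i))"
  proof -
    have "\<exists>w. ?z j = m_ser c j + (\<Sum>l<j. fps_const (w l) * m_ser c l)" for j
      using T_op_funpow_m_ser[of c j] by (auto simp: m_span_def)
    then obtain w where w: "\<And>j. ?z j = m_ser c j + (\<Sum>l<j. fps_const (w j l) * m_ser c l)"
      by metis
    define U where "U l j = (if l = j then 1 else if l < j then w j l else 0)" for l j
    have "?z j $ i = (\<Sum>k<Suc n. m_ser c k $ i * U k j)" if "j < Suc n" for i j
    proof -
      have "(\<Sum>k<Suc n. m_ser c k $ i * U k j) = (\<Sum>k<Suc j. m_ser c k $ i * U k j)"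
        by (rule sum.mono_neutral_right) (use that in \<open>auto simp: U_def\<close>)
      also have "\<dots> = ?z j $ i"
        unfolding w by (simp add: U_def fps_sum_nth mult.commute)
      finally show ?thesis by simp
    qed
    then have "det (mat (Suc n) (Suc n) (\<lambda>(i, j). ?z j $ i))
        = det (mat (Suc n) (Suc n) (\<lambda>(i, j). \<Sum>k<Suc n. m_ser c k $ i * U k j))"
      by (intro det_cong)
    also have "\<dots> = det (mat (Suc n) (Suc n) (\<lambda>(i, j). m_ser c j $ i))"
      unfolding det_mat_mult by (subst (2) det_unit_upper) (auto simp: U_def)
    finally show ?thesis .
  qed
  also have "\<dots> = det (mat (Suc n) (Suc n) (\<lambda>(i, j). (N_ker c * (if j < n then kappa (Suc j) else y_ser c n)) $ i))"
  proof -
    define B where "B l j = (if l = j then 1 else if l = Suc j then 2 * c else 0)" for l j :: nat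
    have "(N_ker c * (if j < n then kappa (Suc j) else y_ser c n)) $ i = (\<Sum>k<Suc n. m_ser c k $ i * B k j)"
      if "i < Suc n" "j < Suc n" for i j
    proof (cases "j < n")
      case True
      have "(\<Sum>k<Suc n. m_ser c k $ i * B k j) = (\<Sum>k\<in>{j, Suc j}. m_ser c k $ i * B k j)"
        by (rule sum.mono_neutral_right) (use True in \<open>auto simp: B_def\<close>)
      then show ?thesis using True by (simp add: N_ker_kappa B_def mult.commute)
    next
      case False
      have "(\<Sum>k<Suc n. m_ser c k $ i * B k j) = (\<Sum>k\<in>{j}. m_ser c k $ i * B k j)"
        by (rule sum.mono_neutral_right) (use False that in \<open>auto simp: B_def\<close>)
      moreover have "j = n" "i \<le> n" using False that by auto
      ultimately show ?thesis by (simp add: N_ker_y_ser B_def)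
    qed
    then have "det (mat (Suc n) (Suc n) (\<lambda>(i, j). (N_ker c * (if j < n then kappa (Suc j) else y_ser c n)) $ i))
        = det (mat (Suc n) (Suc n) (\<lambda>(i, j). \<Sum>k<Suc n. m_ser c k $ i * B k j))"
      by (intro det_cong)
    also have "\<dots> = det (mat (Suc n) (Suc n) (\<lambda>(i, j). m_ser c j $ i))"
      unfolding det_mat_mult by (subst (2) det_unit_lower) (auto simp: B_def)
    finally show ?thesis by simp
  qed
  also have "\<dots> = kappa_det n (y_ser c n)"
    unfolding kappa_det_def by (rule det_unit_series_rows) (simp add: N_ker_def)
  finally show ?thesis by (simp add: c_def)
qed

text \<open>The determinants \<open>\<Delta>\<^sub>n\<close> with columns \<open>\<kappa>\<^sub>1, \<dots>, \<kappa>\<^sub>n\<close>.\<close>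
definition Delta :: "nat \<Rightarrow> rat" where
  "Delta n = det (mat n n (\<lambda>(i, j). kappa (Suc j) $ i))"

text \<open>Replace the last row by \<open>\<ell>\<^sub>n\<close> of the columns. This preserves the determinant because \<open>\<ell>\<^sub>n\<close> has weight 1
  at \<open>s\<^sup>n\<close>, and annihilates the row but for the last entry because \<open>g\<^sub>n\<close> has degree at most \<open>n\<close>.\<close>
lemma kappa_det_eq_ell:
  assumes "n \<ge> 1"
  shows "kappa_det n f = Delta n * ell n f"
proof -
  define V where "V i j = (if j < n then kappa (Suc j) else f) $ i" for i j
  define E where "E i m = (if i < n then (if i = m then 1 else 0) else ell n (fps_X ^ m))" for i m :: nat
  define W where "W i j = (if i < n then V i j else if j = n then ell n f else 0)" for i j
  have EV: "(\<Sum>m<Suc n. E i m * V m j) = W i j" if "i < Suc n" "j < Suc n" for i j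
  proof (cases "i < n")
    case True
    have "(\<Sum>m<Suc n. E i m * V m j) = (\<Sum>m\<in>{i}. E i m * V m j)"
      by (rule sum.mono_neutral_right) (use True in \<open>auto simp: E_def\<close>)
    then show ?thesis using True by (simp add: E_def W_def)
  next
    case False
    have "(\<Sum>m<Suc n. E i m * V m j) = ell n (if j < n then kappa (Suc j) else f)"
      unfolding ell_expand[of n "if j < n then kappa (Suc j) else f"] lessThan_Suc_atMost
      using False by (simp add: E_def V_def)
    also have "\<dots> = W i j"
    proof -
      have "ell n (kappa (Suc j)) = 0" if "j < n"
      proof (cases "j = 0")
        case True
        then show ?thesis using assms by (simp add: ell_lead)
      next
        case False
        then show ?thesis using that by (simp add: ell_kappa int_coeff_g_poly_eq_0 del: kappa.simps)
      qed
      then show ?thesis using False that by (auto simp: W_def)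
    qed
    finally show ?thesis .
  qed
  have "det (mat (Suc n) (Suc n) (\<lambda>(i, j). W i j))
      = det (mat (Suc n) (Suc n) (\<lambda>(i, j). \<Sum>m<Suc n. E i m * V m j))"
    by (intro det_cong) (simp only: EV)
  also have "\<dots> = det (mat (Suc n) (Suc n) (\<lambda>(i, j). V i j))"
    unfolding det_mat_mult
  proof (subst det_unit_lower)
    show "E i i = 1" if "i < Suc n" for i
      using that assms ell_lead[of n "fps_X ^ n"] by (auto simp: E_def less_Suc_eq fps_X_power_nth)
  qed (auto simp: E_def)
  also have "\<dots> = kappa_det n f" by (simp add: kappa_det_def V_def)
  finally have 1: "kappa_det n f = det (mat (Suc n) (Suc n) (\<lambda>(i, j). W i j))" by simp
  let ?W = "mat (Suc n) (Suc n) (\<lambda>(i, j). W i j)"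
  have "det ?W = (\<Sum>j<Suc n. ?W $$ (n, j) * cofactor ?W n j)"
    by (rule laplace_expansion_row) auto
  also have "\<dots> = (\<Sum>j\<in>{n}. ?W $$ (n, j) * cofactor ?W n j)"
    by (rule sum.mono_neutral_right) (auto simp: W_def)
  also have "\<dots> = ell n f * det (mat_delete ?W n n)"
    by (simp add: W_def cofactor_def flip: power_add)
  also have "mat_delete ?W n n = mat n n (\<lambda>(i, j). kappa (Suc j) $ i)"
    by (rule eq_matI) (auto simp: mat_delete_def W_def V_def)
  finally show ?thesis unfolding 1 Delta_def by (simp add: mult.commute)
qed

lemma Delta_Suc: "Delta (Suc n) = Delta n * coeff (g_poly n) n"
proof (cases "n = 0")
  case True
  then show ?thesis by (simp add: Delta_def det_single)
next
  case False
  have "Delta (Suc n) = kappa_det n (kappa (Suc n))"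
    unfolding Delta_def kappa_det_def by (rule det_cong) (auto simp: less_Suc_eq)
  also have "\<dots> = Delta n * int_coeff (g_poly n) (int n)"
    using False by (simp add: kappa_det_eq_ell ell_kappa del: kappa.simps)
  finally show ?thesis by (simp add: int_coeff_def)
qed

lemma H_poly_eq:
  "poly (H_poly n) x = Delta n * (\<Sum>i\<le>n. (- 2 * (x - 1)) ^ i * coeff (g_poly n) (n - i))"
proof (cases "n = 0")
  case True
  then show ?thesis by (simp add: H_poly_eval Delta_def det_single a_poly_def)
next
  case False
  have "ell n (y_ser (x - 1) n) = (\<Sum>i\<le>n. (- 2 * (x - 1)) ^ i * ell n (kappa (n + 1 + i)))"
    unfolding y_ser_def ell_sum ell_const_mult ..
  also have "\<dots> = (\<Sum>i\<le>n. (- 2 * (x - 1)) ^ i * coeff (g_poly n) (n - i))"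
  proof (rule sum.cong)
    fix i assume "i \<in> {..n}"
    then have "ell n (kappa (n + 1 + i)) = int_coeff (g_poly n) (int (n - i))"
      using False by (subst ell_kappa) (auto simp: of_nat_diff)
    then show "(- 2 * (x - 1)) ^ i * ell n (kappa (n + 1 + i)) = (- 2 * (x - 1)) ^ i * coeff (g_poly n) (n - i)"
      by (simp add: int_coeff_def)
  qed simp
  finally show ?thesis using False by (simp add: H_poly_eq_kappa_det kappa_det_eq_ell)
qed

lemma H_poly_eq_g_poly:
  assumes "x \<noteq> 1"
  shows "poly (H_poly n) x = Delta n * (- 2 * (x - 1)) ^ n * poly (g_poly n) (- 1 / (2 * (x - 1)))"
proof -
  define u where "u = - 2 * (x - 1)"
  have u: "u \<noteq> 0" "- 1 / (2 * (x - 1)) = inverse u" using assms by (simp_all add: u_def divide_simps)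
  have "degree (g_poly n) \<le> n" by (rule degree_le) (simp add: g_poly_degree)
  then have "poly (g_poly n) (inverse u) = (\<Sum>i\<le>n. coeff (g_poly n) i * inverse u ^ i)"
    unfolding poly_altdef by (intro sum.mono_neutral_left) (auto simp: coeff_eq_0)
  then have "u ^ n * poly (g_poly n) (inverse u) = (\<Sum>i\<le>n. u ^ (n - i) * coeff (g_poly n) i)"
    using u by (simp add: sum_distrib_left power_diff field_simps)
  also have "\<dots> = (\<Sum>i\<le>n. u ^ i * coeff (g_poly n) (n - i))"
    by (rule sum.reindex_bij_witness[of _ "\<lambda>i. n - i" "\<lambda>i. n - i"]) auto
  finally show ?thesis unfolding u(2) unfolding H_poly_eq u_def[symmetric] by simp
qed

section \<open>The recursion\<close>

lemma g_poly_top_neq_0: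
  "coeff (g_poly n) n \<noteq> 0"
proof -
  have "3 * (3 * of_nat n + 1) * (3 * of_nat n + 2) * fact (2 * n + 1) * fact (6 * n + 1) \<noteq> (0 :: rat)"
    using of_nat_0_le_iff[of n, where 'a = rat] by (simp add: add_nonneg_eq_0_iff)
  then show ?thesis unfolding g_poly_top by simp
qed

lemma Delta_neq_0: "Delta n \<noteq> 0"
proof (induction n)
  case 0
  show ?case by (simp add: Delta_def)
qed (simp add: Delta_Suc g_poly_top_neq_0)

lemma p_poly_Suc_Suc:
  "p_poly (Suc (Suc n)) = smult (4 / (coeff (g_poly (Suc n)) (Suc n))\<^sup>2) ([:-1, 1:]\<^sup>2)"
proof -
  have i: "4 * Suc (Suc n) - 3 = 4 * Suc n + 1" "4 * Suc (Suc n) - 1 = 4 * Suc n + 3"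
    "2 * Suc (Suc n) - 1 = 2 * Suc n + 1" "6 * Suc (Suc n) - 5 = 6 * Suc n + 1" by auto
  define N :: rat where "N = of_nat (Suc n)"
  have N: "of_nat (Suc (Suc n)) = N + 1" by (simp add: N_def)
  define F1 F2 F3 F4 :: rat where "F1 = fact (2 * Suc n + 1)" and "F2 = fact (6 * Suc n + 1)"
    and "F3 = fact (4 * Suc n + 1)" and "F4 = fact (4 * Suc n + 3)"
  have e: "3 * (N + 1) - 2 = 3 * N + 1" "3 * (N + 1) - 1 = 3 * N + 2" by simp_all
  show ?thesis
    unfolding p_poly_def Let_def i N g_poly_top e unfolding N_def[symmetric] F1_def[symmetric]
      F2_def[symmetric] F3_def[symmetric] F4_def[symmetric]
    by (simp add: power2_eq_square mult_ac) (simp add: algebra_simps)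
qed

lemma q_poly_Suc_Suc:
  fixes n :: nat and x :: rat
  defines "A \<equiv> coeff (g_poly (Suc n)) (Suc n)"
  shows "poly (q_poly (Suc (Suc n))) x
    = ((2 * x - 3) ^ 3 + 2 * (x - 1) * rec_beta (of_nat n + 2)) / A"
proof -
  have i: "4 * Suc (Suc n) - 5 = 4 * n + 3" "4 * Suc (Suc n) - 1 = 4 * Suc n + 3"
    "2 * Suc (Suc n) - 1 = 2 * Suc n + 1" "6 * Suc (Suc n) - 5 = 6 * Suc n + 1" by auto
  define N :: rat where "N = of_nat n"
  have N: "of_nat (Suc (Suc n)) = N + 2" "of_nat (Suc n) = N + 1" by (simp_all add: N_def)
  have N0: "N \<ge> 0" by (simp add: N_def)
  define F1 F2 F3 F4 :: rat where "F1 = fact (2 * Suc n + 1)" and "F2 = fact (6 * Suc n + 1)"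
    and "F3 = fact (4 * n + 3)" and "F4 = fact (4 * Suc n + 3)"
  have F: "F1 \<noteq> 0" "F2 \<noteq> 0" "F3 \<noteq> 0" "F4 \<noteq> 0" by (simp_all add: F1_def F2_def F3_def F4_def)
  have f: "fact (4 * Suc n + 1) = (4 * N + 5) * (4 * (N + 1)) * F3"
  proof -
    have "4 * Suc n + 1 = Suc (Suc (4 * n + 3))" by simp
    then show ?thesis unfolding F3_def by (simp only: fact_Suc) (simp add: N_def algebra_simps)
  qed
  have A: "A = 3 * (3 * N + 4) * (3 * N + 5) * F1 * F2 / ((4 * N + 5) * (4 * (N + 1)) * F3 * F4)"
    unfolding A_def g_poly_top f N unfolding F1_def[symmetric] F2_def[symmetric] F4_def[symmetric]
    by (simp add: algebra_simps)
  have nz: "4 * N + 5 \<noteq> 0" "4 * N + 9 \<noteq> 0" "N + 1 \<noteq> 0" "3 * N + 4 \<noteq> 0" "3 * N + 5 \<noteq> 0"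
    using N0 by auto
  define P where "P = [: - 3 * (108 * (N + 2)\<^sup>2 - 54 * (N + 2) - 19),
          6 * (126 * (N + 2)\<^sup>2 - 63 * (N + 2) - 23),
          - 36 * (4 * (N + 2) - 3) * (4 * (N + 2) + 1),
          8 * (4 * (N + 2) - 3) * (4 * (N + 2) + 1) :]"
  have P: "poly P x = (4 * N + 5) * (4 * N + 9) * ((2 * x - 3) ^ 3 + 2 * (x - 1) * rec_beta (N + 2))"
  proof -
    have b: "(4 * N + 5) * (4 * N + 9) * rec_beta (N + 2) = - 3 * (18 * (N+2)\<^sup>2 - 9 * (N+2) - 4)"
      unfolding rec_beta_shift using nz by simp
    have "poly P x = (4 * N + 5) * (4 * N + 9) * (2 * x - 3) ^ 3
        + 2 * (x - 1) * (- 3 * (18 * (N+2)\<^sup>2 - 9 * (N+2) - 4))"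
      unfolding P_def by (simp add: algebra_simps power2_eq_square power3_eq_cube)
    also have "\<dots> = (4 * N + 5) * (4 * N + 9) * ((2 * x - 3) ^ 3 + 2 * (x - 1) * rec_beta (N + 2))"
      unfolding b[symmetric] by (simp only: distrib_left mult_ac)
    finally show ?thesis .
  qed
  have e: "N + 2 - 1 = N + 1" "3 * (N + 2) - 2 = 3 * N + 4" "3 * (N + 2) - 1 = 3 * N + 5"
    "4 * (N + 2) + 1 = 4 * N + 9" by simp_all
  have "poly (q_poly (Suc (Suc n))) x = 4 * (N + 1) * F3 * F4
      / (3 * (3 * N + 4) * (3 * N + 5) * (4 * N + 9) * F1 * F2) * poly P x"
    unfolding q_poly_def Let_def i N P_def F1_def F2_def F3_def F4_def poly_smult e ..
  also have "\<dots> = ((2 * x - 3) ^ 3 + 2 * (x - 1) * rec_beta (N + 2)) / A"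
    unfolding P A using nz F by simp (simp add: mult_ac)
  finally show ?thesis unfolding N_def .
qed

text \<open>Away from \<open>x = 1\<close>, with \<open>u = -2(x-1)\<close>, this is the recursion for \<open>g\<^bsub>n+2\<^esub>\<close> evaluated at \<open>1/u\<close>.\<close>
lemma H_poly_recursion:
  "p_poly (Suc (Suc n)) * H_poly (Suc (Suc n)) + q_poly (Suc (Suc n)) * H_poly (Suc n) + H_poly n = 0"
  (is "?p = 0")
proof (rule ccontr)
  assume "?p \<noteq> 0"
  then have "finite {x. poly ?p x = 0}" by (rule poly_roots_finite)
  moreover have "UNIV - {1} \<subseteq> {x. poly ?p x = 0}"
  proof
    fix x :: rat assume "x \<in> UNIV - {1}"
    then have x: "x \<noteq> 1" by simp
    define u where "u = - 2 * (x - 1)"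
    have u: "u \<noteq> 0" "- 1 / (2 * (x - 1)) = 1 / u" using x by (simp_all add: u_def divide_simps)
    define A A' where "A = coeff (g_poly (Suc n)) (Suc n)" and "A' = coeff (g_poly n) n"
    have AA: "A \<noteq> 0" "A' \<noteq> 0" by (simp_all add: A_def A'_def g_poly_top_neq_0 del: g_poly.simps)
    define \<beta> where "\<beta> = rec_beta (of_nat n + 2)"
    define G0 G1 G2 where "G0 = poly (g_poly n) (1 / u)" and "G1 = poly (g_poly (Suc n)) (1 / u)"
      and "G2 = poly (g_poly (Suc (Suc n))) (1 / u)"
    have \<alpha>: "rec_alpha (of_nat n + 2) = A / A'"
      using AA unfolding A_def A'_def g_poly_top_step by simp
    have G2: "G2 = (1 + 3 / u + (3 + \<beta>) / u ^ 2 + 1 / u ^ 3) * G1 - A / A' * (1 / u ^ 4) * G0"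
      unfolding G2_def g_poly.simps(3) \<alpha> \<beta>_def[symmetric] using u(1)
      by (simp add: G1_def G0_def field_simps power2_eq_square power3_eq_cube power4_eq_xxxx del: g_poly.simps)
    define D where "D = Delta n"
    have H0: "poly (H_poly n) x = D * u ^ n * G0"
      unfolding H_poly_eq_g_poly[OF x] D_def G0_def u(2) u_def ..
    have H1: "poly (H_poly (Suc n)) x = D * A' * u * u ^ n * G1"
      unfolding H_poly_eq_g_poly[OF x] Delta_Suc D_def A'_def G1_def u(2) unfolding u_def by simp
    have H2: "poly (H_poly (Suc (Suc n))) x = D * A' * A * u ^ 2 * u ^ n * G2"
      unfolding H_poly_eq_g_poly[OF x] Delta_Suc D_def A_def A'_def G2_def u(2) unfolding u_def
      by (simp add: power2_eq_square del: g_poly.simps)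
    have p: "poly (p_poly (Suc (Suc n))) x = u ^ 2 / A ^ 2"
      unfolding p_poly_Suc_Suc A_def[symmetric] using AA by (simp add: u_def field_simps power2_eq_square)
    have q: "poly (q_poly (Suc (Suc n))) x = - ((u + 1) ^ 3 + u * \<beta>) / A"
      unfolding q_poly_Suc_Suc A_def[symmetric] \<beta>_def[symmetric] using AA
      by (simp add: u_def field_simps power3_eq_cube)
    have "u ^ 4 * A' * G2 = A' * (u * (u + 1) ^ 3 + u ^ 2 * \<beta>) * G1 - A * G0"
      unfolding G2 using u AA by (simp add: field_simps power2_eq_square power3_eq_cube power4_eq_xxxx)
    then have "u ^ 4 * A' * G2 - A' * (u * (u + 1) ^ 3 + u ^ 2 * \<beta>) * G1 + A * G0 = 0" by simp
    then have "D * u ^ n / A * (u ^ 4 * A' * G2 - A' * (u * (u + 1) ^ 3 + u ^ 2 * \<beta>) * G1 + A * G0) = 0"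
      by simp
    moreover have "poly ?p x
      = D * u ^ n / A * (u ^ 4 * A' * G2 - A' * (u * (u + 1) ^ 3 + u ^ 2 * \<beta>) * G1 + A * G0)"
      unfolding poly_add poly_mult H0 H1 H2 p q using AA
      by (simp add: field_simps power2_eq_square power3_eq_cube power4_eq_xxxx)
    ultimately show "x \<in> {x. poly ?p x = 0}" by simp
  qed
  ultimately have "finite (UNIV - {1 :: rat})" by (rule rev_finite_subset)
  then show False by (simp add: infinite_UNIV_char_0)
qed

lemma H_poly_0: "H_poly 0 = 1"
  by (rule poly_eq_poly_eq_iff[THEN iffD1], rule ext) (simp add: H_poly_eq Delta_def)

lemma H_poly_1: "H_poly 1 = [:5, -2:]"
proof (rule poly_eq_poly_eq_iff[THEN iffD1], rule ext)
  fix x :: rat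
  have "Delta 1 = 1" by (simp add: Delta_def det_single)
  then show "poly (H_poly 1) x = poly [:5, -2:] x"
    unfolding H_poly_eq by (simp add: algebra_simps)
qed

theorem theorem3:
  shows "H_poly 0 = 1 \<and> H_poly 1 = [:5, -2:] \<and>
    (\<forall>n\<ge>2. p_poly n * H_poly n + q_poly n * H_poly (n - 1) + H_poly (n - 2) = 0)"
proof (intro conjI allI impI)
  fix n :: nat assume "n \<ge> 2"
  then obtain m where "n = Suc (Suc m)" by (metis add_2_eq_Suc le_Suc_ex)
  then show "p_poly n * H_poly n + q_poly n * H_poly (n - 1) + H_poly (n - 2) = 0"
    using H_poly_recursion[of m] by simp
qed (rule H_poly_0 H_poly_1)+

end
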